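(* Suppose $n$ is a positive integer that is not a product of two primes and $n=p_1^{\alpha_1}p_2^{\alpha_2}\cdots p_r^{\alpha_r}$, where $r \geq 2$, $p_1 < p_2 < \cdots < p_r$ are primes and $\alpha_i \in \mathbb{N}$ for $1\le i\le r$. Let $$\xi_1(n) = \phi(n)+\frac{n}{p_r} - p_r^{\alpha_r-1} \phi\left(\frac{n}{p_r^{\alpha_r}}\right),\qquad \xi_2(n) = \phi(n) + \frac{n}{p_r^{\alpha_r}} + \phi\left(\frac{n}{p_r^{\alpha_r}}\right) \left(p_r^{\alpha_r-1}-2\right).$$ Then: (i) $\xi_2(n) = \xi_1(n)$ if and only if $\alpha_r=1$, or $r=2$ and $p_1=2$. (ii) $\xi_2(n) < \xi_1(n)$ if and only if $\alpha_r \geq 2$ and $\prod_{i=1}^{r-1} \left(1- \frac{1}{p_i}\right) < \frac{1}{2}$. (iii) $\xi_2(n) > \xi_1(n)$ if and only if $\alpha_r \geq 2$ and $\prod_{i=1}^{r-1} \left(1- \frac{1}{p_i}\right) > \frac{1}{2}$.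
   Context: $\mathbb{N}$ denotes the positive integers and $\phi$ is Euler's phi function. The quantities $\xi_1(n),\xi_2(n)$ are integers (subtraction is taken in the integers). They are two upper bounds for the vertex connectivity of the power graph of $\mathbb{Z}_n$. *)

theory Defs
  imports Complex_Main "HOL-Number_Theory.Number_Theory"
begin

text \<open>
  The two upper bounds for the vertex connectivity of the power graph of the cyclic group
  of order \<open>n\<close>.  The parameters \<open>q\<close> and \<open>a\<close> stand for the largest prime divisor \<open>p\<^sub>r\<close> of \<open>n\<close>
  and its exponent \<open>\<alpha>\<^sub>r \<ge> 1\<close> in \<open>n\<close>, so both uses of \<open>div\<close> are exact; subtraction takes
  place in the integers, except in the exponent \<open>a - 1\<close>, where \<open>a \<ge> 1\<close>.
\<close>

definition xi1 :: "nat \<Rightarrow> nat \<Rightarrow> nat \<Rightarrow> int" where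
  "xi1 n q a =
     int (totient n) + int (n div q) - int q ^ (a - 1) * int (totient (n div q ^ a))"

definition xi2 :: "nat \<Rightarrow> nat \<Rightarrow> nat \<Rightarrow> int" where
  "xi2 n q a =
     int (totient n) + int (n div q ^ a) + int (totient (n div q ^ a)) * (int q ^ (a - 1) - 2)"

end

theory Submission
  imports Defs
begin

text \<open>
  Write \<open>q\<close> and \<open>a\<close> for the largest prime and its exponent, and \<open>n = m q\<^sup>a\<close>.  The term \<open>\<phi>(n)\<close>
  is common to both bounds, and the rest of the difference factors as
  \<open>\<xi>\<^sub>1(n) - \<xi>\<^sub>2(n) = (q\<^bsup>a-1\<^esup> - 1) (m - 2 \<phi>(m))\<close>.  The first factor is never negative and
  vanishes exactly when \<open>a = 1\<close>.  Since \<open>\<phi>(m)/m\<close> is the product of the \<open>1 - 1/p\<^sub>i\<close> over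
  \<open>i < r\<close>, the sign of the second factor is decided by comparing that product with \<open>1/2\<close>
  (\<open>sgn_xi1_minus_xi2\<close>).  All three claims follow once the case of equality is understood:
  the product is \<open>1/2\<close> only when \<open>2\<close> is the sole prime involved
  (\<open>prod_one_minus_inverse_primes_eq_half_iff\<close>).
\<close>

lemma xi1_minus_xi2:
  assumes "q > 0" "a \<ge> 1"
  shows "xi1 (m * q ^ a) q a - xi2 (m * q ^ a) q a =
           (int q ^ (a - 1) - 1) * (int m - 2 * int (totient m))"
proof -
  from \<open>a \<ge> 1\<close> obtain b where b: "a = Suc b"
    by (cases a) auto
  have "m * q ^ a div q = m * q ^ b" "m * q ^ a div q ^ a = m"
    using \<open>q > 0\<close> by (simp_all add: b mult.left_commute)
  then show ?thesis
    by (simp add: xi1_def xi2_def b algebra_simps)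
qed

lemma sgn_xi1_minus_xi2:
  assumes "q \<ge> 2" "a \<ge> 1" "m > 0"
  shows "sgn (real_of_int (xi1 (m * q ^ a) q a - xi2 (m * q ^ a) q a)) =
           (if a = 1 then 0 else sgn (1 / 2 - (\<Prod>p\<in>prime_factors m. 1 - 1 / real p)))"
proof (cases "a = 1")
  case True
  then show ?thesis
    using xi1_minus_xi2[of q a m] assms by simp
next
  case False
  define P where "P = (\<Prod>p\<in>prime_factors m. 1 - 1 / real p)"
  have "real q ^ (a - 1) > 1"
    using assms False by (intro one_less_power) auto
  moreover have "real (totient m) = real m * P"
    unfolding P_def by (rule totient_formula2)
  moreover have "real_of_int (xi1 (m * q ^ a) q a - xi2 (m * q ^ a) q a) =
      (real q ^ (a - 1) - 1) * (real m - 2 * real (totient m))"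
    using xi1_minus_xi2[of q a m] assms by simp
  ultimately have "real_of_int (xi1 (m * q ^ a) q a - xi2 (m * q ^ a) q a) =
      ((real q ^ (a - 1) - 1) * (2 * real m)) * (1 / 2 - P)"
    by (simp add: algebra_simps)
  then show ?thesis
    using False \<open>real q ^ (a - 1) > 1\<close> \<open>m > 0\<close> by (simp add: sgn_mult P_def)
qed

text \<open>
  Cleared of denominators, the equation reads \<open>2 \<Prod>(p - 1) = \<Prod>p\<close>.  The largest prime in
  \<open>S\<close> divides the right-hand side but is too big to divide any of the positive
  numbers \<open>p - 1\<close>, so it divides \<open>2\<close>.
\<close>
lemma prod_one_minus_inverse_primes_eq_half_iff:
  fixes S :: "nat set"
  assumes "finite S" and primes: "\<And>p. p \<in> S \<Longrightarrow> prime p"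
  shows "(\<Prod>p\<in>S. 1 - 1 / real p) = 1 / 2 \<longleftrightarrow> S = {2}"
proof
  assume half: "(\<Prod>p\<in>S. 1 - 1 / real p) = 1 / 2"
  then have "S \<noteq> {}"
    by auto
  have pos: "p > 0" if "p \<in> S" for p
    using primes[OF that] by (rule prime_gt_0_nat)
  have "real (\<Prod>p\<in>S. p - 1) = (\<Prod>p\<in>S. real p * (1 - 1 / real p))"
    unfolding of_nat_prod
  proof (rule prod.cong)
    fix p assume "p \<in> S"
    then have "p > 0"
      by (rule pos)
    then show "real (p - 1) = real p * (1 - 1 / real p)"
      by (simp add: of_nat_diff field_simps)
  qed simp
  also have "\<dots> = real (\<Prod>S) * (1 / 2)"
    by (simp add: prod.distrib half)
  finally have "real (2 * (\<Prod>p\<in>S. p - 1)) = real (\<Prod>S)"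
    by simp
  then have eq: "2 * (\<Prod>p\<in>S. p - 1) = \<Prod>S"
    by linarith
  define M where "M = Max S"
  have M: "M \<in> S" "\<And>p. p \<in> S \<Longrightarrow> p \<le> M"
    using assms \<open>S \<noteq> {}\<close> by (auto simp: M_def)
  have "M dvd 2 * (\<Prod>p\<in>S. p - 1)"
    unfolding eq using dvd_prodI[OF \<open>finite S\<close> M(1), of "\<lambda>p. p"] by simp
  moreover have "\<not> M dvd (\<Prod>p\<in>S. p - 1)"
  proof
    assume "M dvd (\<Prod>p\<in>S. p - 1)"
    then obtain p where p: "p \<in> S" "M dvd p - 1"
      using prime_dvd_prod_iff[OF \<open>finite S\<close> primes[OF M(1)]] by auto
    have "0 < p - 1" "p - 1 < M"
      using prime_gt_1_nat[OF primes[OF p(1)]] M(2)[OF p(1)] by auto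
    with p(2) show False
      using nat_dvd_not_less by blast
  qed
  ultimately have "M dvd 2"
    using primes[OF M(1)] by (simp add: prime_dvd_mult_iff)
  then have "M \<le> 2"
    by (simp add: dvd_imp_le)
  then have "p = 2" if "p \<in> S" for p
    using M(2)[OF that] prime_ge_2_nat[OF primes[OF that]] by linarith
  then show "S = {2}"
    using \<open>S \<noteq> {}\<close> by auto
qed simp

lemma prime_factors_prod_prime_powers:
  fixes f e :: "'b \<Rightarrow> nat"
  assumes "finite I" "\<And>i. i \<in> I \<Longrightarrow> prime (f i)" "\<And>i. i \<in> I \<Longrightarrow> e i \<ge> 1"
  shows "prime_factors (\<Prod>i\<in>I. f i ^ e i) = f ` I"
proof -
  have "prime_factors (f i ^ e i) = {f i}" if "i \<in> I" for i
    using assms(2,3)[OF that] by (simp add: prime_factors_power prime_prime_factors)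
  moreover have "0 \<notin> (\<lambda>i. f i ^ e i) ` I"
    using prime_gt_0_nat[OF assms(2)] by fastforce
  ultimately show ?thesis
    using prime_factors_prod[OF \<open>finite I\<close>, of "\<lambda>i. f i ^ e i"] by auto
qed

theorem theorem2p25:
  fixes n r :: nat and p \<alpha> :: "nat \<Rightarrow> nat"
  assumes "n > 0"
    and "\<not> (\<exists>q1 q2 :: nat. prime q1 \<and> prime q2 \<and> n = q1 * q2)"
    and "r \<ge> 2"
    and "\<And>i. i \<in> {1..r} \<Longrightarrow> prime (p i)"
    and "strict_mono_on {1..r} p"
    and "\<And>i. i \<in> {1..r} \<Longrightarrow> \<alpha> i \<ge> 1"
    and "n = (\<Prod>i = 1..r. p i ^ \<alpha> i)"
  shows "(xi2 n (p r) (\<alpha> r) = xi1 n (p r) (\<alpha> r) \<longleftrightarrow> \<alpha> r = 1 \<or> (r = 2 \<and> p 1 = 2))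
    \<and> (xi2 n (p r) (\<alpha> r) < xi1 n (p r) (\<alpha> r) \<longleftrightarrow>
         \<alpha> r \<ge> 2 \<and> (\<Prod>i = 1..r - 1. 1 - 1 / real (p i)) < 1 / 2)
    \<and> (xi2 n (p r) (\<alpha> r) > xi1 n (p r) (\<alpha> r) \<longleftrightarrow>
         \<alpha> r \<ge> 2 \<and> (\<Prod>i = 1..r - 1. 1 - 1 / real (p i)) > 1 / 2)"
proof -
  define m where "m = (\<Prod>i = 1..r - 1. p i ^ \<alpha> i)"
  define P where "P = (\<Prod>i = 1..r - 1. 1 - 1 / real (p i))"
  have r: "r \<in> {1..r}" "Suc (r - 1) = r"
    using \<open>r \<ge> 2\<close> by auto
  have n: "n = m * p r ^ \<alpha> r"
    using assms(7) prod.nat_ivl_Suc'[of 1 "r - 1" "\<lambda>i. p i ^ \<alpha> i"] r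
    by (simp add: m_def mult.commute)
  have "m > 0"
    using \<open>n > 0\<close> n by simp
  have inj: "inj_on p {1..r - 1}"
    using strict_mono_on_imp_inj_on[OF assms(5)] by (rule inj_on_subset) auto
  have factors: "prime_factors m = p ` {1..r - 1}"
    unfolding m_def by (rule prime_factors_prod_prime_powers) (use assms(4,6) in auto)
  have P: "P = (\<Prod>q\<in>prime_factors m. 1 - 1 / real q)"
    unfolding P_def factors using inj by (simp add: prod.reindex)

  have "P = 1 / 2 \<longleftrightarrow> prime_factors m = {2}"
    unfolding P by (rule prod_one_minus_inverse_primes_eq_half_iff) auto
  also have "\<dots> \<longleftrightarrow> r = 2 \<and> p 1 = 2"
  proof
    assume "prime_factors m = {2}"
    then have img: "p ` {1..r - 1} = {2}"
      by (simp add: factors)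
    then have "card {1..r - 1} = 1"
      using card_image[OF inj] by simp
    then have "r = 2"
      by simp
    then show "r = 2 \<and> p 1 = 2"
      using img by simp
  qed (simp add: factors)
  finally have half: "P = 1 / 2 \<longleftrightarrow> r = 2 \<and> p 1 = 2" .

  have "\<alpha> r \<ge> 1"
    using assms(6) r by blast
  then have sgn: "sgn (real_of_int (xi1 n (p r) (\<alpha> r) - xi2 n (p r) (\<alpha> r))) =
      (if \<alpha> r = 1 then 0 else sgn (1 / 2 - P))"
    unfolding n P using sgn_xi1_minus_xi2 prime_ge_2_nat[OF assms(4)[OF r(1)]] \<open>m > 0\<close>
    by blast
  show ?thesis
    unfolding P_def[symmetric] half[symmetric]
    using sgn \<open>\<alpha> r \<ge> 1\<close> by (auto simp: sgn_if split: if_splits)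
qed

end
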